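(* Let $\langle\mathbf{A},\forall,\exists\rangle$ be an Epistemic BL-algebra whose BL-reduct $\mathbf{A}$ is a Boolean algebra, and let $F$ be a filter of $\mathbf{A}$. Then $F$ is an epistemic BL-filter if and only if $F$ is a $\forall$-filter.
   Context: A BL-algebra is an algebra $\langle A,\wedge,\vee,\ast,\to,0,1\rangle$ such that $\langle A,\wedge,\vee,0,1\rangle$ is a bounded lattice, $\langle A,\ast,1\rangle$ is a commutative monoid, $a\ast b\le c$ iff $a\le b\to c$, and $a\wedge b=a\ast(a\to b)$ and $(a\to b)\vee(b\to a)=1$ hold; a Boolean algebra is regarded as a BL-algebra with $\ast=\wedge$ and $a\to b=\neg a\vee b$. An Epistemic BL-algebra is a BL-algebra with unary operations $\forall,\exists$ satisfying, for all $a,b$: $\forall 1=1$; $\exists 0=0$; $\forall a\to\exists a=1$; $\forall(a\to\forall b)=\exists a\to\forall b$; $\forall(\forall a\to b)=\forall a\to\forall b$; $\exists a\to\forall\exists a=1$; $\forall(a\wedge b)=\forall a\wedge\forall b$; $\exists(a\vee b)=\exists a\vee\exists b$; $\exists(a\ast\exists b)=\exists a\ast\exists b$. A filter (implicative filter) is a subset $F$ with $1\in F$ such that $x\in F$ and $x\to y\in F$ imply $y\in F$. An epistemic BL-filter is a filter $F$ such that $a\to b\in F$ implies $\forall a\to\forall b\in F$ and $\exists a\to\exists b\in F$. A $\forall$-filter is a filter $F$ such that $a\in F$ implies $\forall a\in F$. *)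

theory Defs
  imports Main
begin

text \<open>
  The universe of the algebra is the type \<open>'a\<close>; the bounded lattice structure, with
  \<open>0 = bot\<close> and \<open>1 = top\<close>, is taken from the type class, the remaining operations
  are explicit parameters.
\<close>

locale bl_algebra = comm_monoid mult top
  for mult :: "'a::bounded_lattice \<Rightarrow> 'a \<Rightarrow> 'a" +
  fixes imp :: "'a \<Rightarrow> 'a \<Rightarrow> 'a"
  assumes residuation: "mult a b \<le> c \<longleftrightarrow> a \<le> imp b c"
    and divisibility: "inf a b = mult a (imp a b)"
    and prelinearity: "sup (imp a b) (imp b a) = top"

definition boolean_bl_algebra ::
    "('a::bounded_lattice \<Rightarrow> 'a \<Rightarrow> 'a) \<Rightarrow> ('a \<Rightarrow> 'a \<Rightarrow> 'a) \<Rightarrow> bool" where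
  "boolean_bl_algebra mult imp \<longleftrightarrow>
     (\<exists>neg. abstract_boolean_algebra inf sup neg (bot::'a) top \<and>
            (\<forall>a b. mult a b = inf a b) \<and>
            (\<forall>a b. imp a b = sup (neg a) b))"

lemma boolean_bl_algebra_imp_bl_algebra:
  assumes "boolean_bl_algebra mult imp"
  shows "bl_algebra mult imp"
proof -
  obtain neg where B: "abstract_boolean_algebra inf sup neg (bot::'a) top"
    and m: "\<And>a b. mult a b = inf a b" and i: "\<And>a b. imp a b = sup (neg a) b"
    using assms unfolding boolean_bl_algebra_def by blast
  interpret B: abstract_boolean_algebra inf sup neg "bot::'a" top by (rule B)
  have res: "inf a b \<le> c \<longleftrightarrow> a \<le> sup (neg b) c" for a b c
  proof
    assume h: "inf a b \<le> c"
    have "a = sup (inf a (neg b)) (inf a b)"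
      by (metis B.conj_disj_distrib B.disj_cancel_left B.conj_one_right)
    also have "\<dots> \<le> sup (neg b) c" using h by (meson inf_le2 sup_mono)
    finally show "a \<le> sup (neg b) c" .
  next
    assume "a \<le> sup (neg b) c"
    then have "inf a b \<le> inf (sup (neg b) c) b" by (rule inf_mono) simp
    also have "\<dots> = inf c b"
      by (metis B.conj_disj_distrib2 B.conj_cancel_left sup_bot_left)
    finally show "inf a b \<le> c" by simp
  qed
  show ?thesis
  proof
    fix a b c
    show "mult (mult a b) c = mult a (mult b c)" by (simp add: m inf.assoc)
    show "mult a b = mult b a" by (simp add: m inf.commute)
    show "mult a top = a" by (simp add: m)
    show "mult a b \<le> c \<longleftrightarrow> a \<le> imp b c" by (simp add: m i res)
    show "inf a b = mult a (imp a b)"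
      unfolding m i by (metis B.conj_disj_distrib B.conj_cancel_right sup_bot_left)
    show "sup (imp a b) (imp b a) = top"
      unfolding i by (metis B.disj_cancel_left B.disj_one_right sup.assoc sup.left_commute sup.commute)
  qed
qed

locale epistemic_bl_algebra = bl_algebra mult imp
  for mult :: "'a::bounded_lattice \<Rightarrow> 'a \<Rightarrow> 'a" and imp :: "'a \<Rightarrow> 'a \<Rightarrow> 'a" +
  fixes all ex :: "'a \<Rightarrow> 'a"
  assumes all_top: "all top = top"
    and ex_bot: "ex bot = bot"
    and all_imp_ex: "imp (all a) (ex a) = top"
    and all_imp_all_right: "all (imp a (all b)) = imp (ex a) (all b)"
    and all_imp_all_left: "all (imp (all a) b) = imp (all a) (all b)"
    and ex_imp_all_ex: "imp (ex a) (all (ex a)) = top"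
    and all_inf: "all (inf a b) = inf (all a) (all b)"
    and ex_sup: "ex (sup a b) = sup (ex a) (ex b)"
    and ex_mult_ex: "ex (mult a (ex b)) = mult (ex a) (ex b)"

definition implicative_filter :: "('a::bounded_lattice \<Rightarrow> 'a \<Rightarrow> 'a) \<Rightarrow> 'a set \<Rightarrow> bool" where
  "implicative_filter imp F \<longleftrightarrow>
     top \<in> F \<and> (\<forall>x y. x \<in> F \<longrightarrow> imp x y \<in> F \<longrightarrow> y \<in> F)"

definition epistemic_bl_filter ::
    "('a::bounded_lattice \<Rightarrow> 'a \<Rightarrow> 'a) \<Rightarrow> ('a \<Rightarrow> 'a) \<Rightarrow> ('a \<Rightarrow> 'a) \<Rightarrow> 'a set \<Rightarrow> bool" where
  "epistemic_bl_filter imp all ex F \<longleftrightarrow>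
     implicative_filter imp F \<and>
     (\<forall>a b. imp a b \<in> F \<longrightarrow> imp (all a) (all b) \<in> F \<and> imp (ex a) (ex b) \<in> F)"

definition forall_filter ::
    "('a::bounded_lattice \<Rightarrow> 'a \<Rightarrow> 'a) \<Rightarrow> ('a \<Rightarrow> 'a) \<Rightarrow> 'a set \<Rightarrow> bool" where
  "forall_filter imp all F \<longleftrightarrow>
     implicative_filter imp F \<and> (\<forall>a. a \<in> F \<longrightarrow> all a \<in> F)"

end

theory Submission
  imports Defs
begin

text \<open>
  In the Boolean case \<open>a \<and> (a \<rightarrow> b) \<le> b\<close>, and \<open>\<forall>\<close> preserves meets, so \<open>\<forall>(a \<rightarrow> b) \<le> \<forall>a \<rightarrow> \<forall>b\<close>; hence a
  \<open>\<forall>\<close>-filter respects \<open>\<forall>\<close>. Taking \<open>b = 0\<close> in \<open>\<forall>(a \<rightarrow> \<forall>b) = \<exists>a \<rightarrow> \<forall>b\<close> and using \<open>\<forall>0 = 0\<close> gives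
  \<open>\<forall>\<not>a = \<not>\<exists>a\<close>, and contraposition reduces the condition on \<open>\<exists>\<close> to the one on \<open>\<forall>\<close>.
\<close>

lemma (in bl_algebra) imp_eq_top_iff: "imp a b = top \<longleftrightarrow> a \<le> b"
  using residuation[of top a b] by (simp add: commute top_unique)

lemma (in bl_algebra) imp_top_left: "imp top a = a"
  using divisibility[of top a] by (simp add: commute)

lemma (in bl_algebra) implicative_filter_upward_closed:
  assumes "implicative_filter imp F" "a \<in> F" "a \<le> b"
  shows "b \<in> F"
  using assms unfolding implicative_filter_def by (metis imp_eq_top_iff)

context epistemic_bl_algebra
begin

lemma all_mono: "a \<le> b \<Longrightarrow> all a \<le> all b"
  by (metis all_inf inf.absorb_iff1)

lemma all_bot: "all bot = bot"
  using all_imp_ex[of bot] by (simp add: imp_eq_top_iff ex_bot bot_unique)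

lemma all_imp_bot: "all (imp a bot) = imp (ex a) bot"
  using all_imp_all_right[of a bot] by (simp add: all_bot)

text \<open>Residuation concerns \<open>mult\<close> while \<open>all\<close> preserves meets; the
  assumption links the two.\<close>

lemma all_imp_le:
  assumes "\<And>a b. mult a b = inf a b"
  shows "all (imp a b) \<le> imp (all a) (all b)"
proof -
  have "inf (imp a b) a \<le> b"
    using residuation[of "imp a b" a b] by (simp add: assms)
  then have "inf (all (imp a b)) (all a) \<le> all b"
    using all_mono by (fastforce simp flip: all_inf)
  then show ?thesis
    using residuation[of "all (imp a b)" "all a" "all b"] by (simp add: assms)
qed

text \<open>Each \<open>a\<close> equals \<open>imp top a\<close>, and \<open>all top = top\<close>,
  so the condition on \<open>all\<close> yields \<open>all a\<close>.\<close>

lemma epistemic_bl_filter_imp_forall_filter: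
  assumes "epistemic_bl_filter imp all ex F"
  shows "forall_filter imp all F"
  using assms unfolding epistemic_bl_filter_def forall_filter_def
  by (metis all_top imp_top_left)

end

lemma boolean_bl_algebra_mult:
  "boolean_bl_algebra mult imp \<Longrightarrow> mult a b = inf a b"
  unfolding boolean_bl_algebra_def by blast

text \<open>Negation appears as \<open>imp x bot\<close>, since \<open>neg\<close> is only given
  existentially.\<close>

lemma boolean_bl_algebra_contraposition:
  fixes imp :: "'a::bounded_lattice \<Rightarrow> 'a \<Rightarrow> 'a"
  assumes "boolean_bl_algebra mult imp"
  shows "imp (imp b bot) (imp a bot) = imp a b"
proof -
  obtain neg where B: "abstract_boolean_algebra inf sup neg (bot::'a) top"
    and i: "\<And>a b. imp a b = sup (neg a) b"
    using assms unfolding boolean_bl_algebra_def by blast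
  interpret B: abstract_boolean_algebra inf sup neg "bot::'a" top by (rule B)
  show ?thesis
    by (simp add: i sup.commute)
qed

theorem theorem4:
  fixes mult imp :: "'a::bounded_lattice \<Rightarrow> 'a \<Rightarrow> 'a"
    and all ex :: "'a \<Rightarrow> 'a"
    and F :: "'a set"
  assumes "epistemic_bl_algebra mult imp all ex"
    and "boolean_bl_algebra mult imp"
    and "implicative_filter imp F"
  shows "epistemic_bl_filter imp all ex F \<longleftrightarrow> forall_filter imp all F"
proof
  interpret epistemic_bl_algebra mult imp all ex by (rule assms(1))
  show "forall_filter imp all F" if "epistemic_bl_filter imp all ex F"
    using that by (rule epistemic_bl_filter_imp_forall_filter)
  show "epistemic_bl_filter imp all ex F" if F: "forall_filter imp all F"
  proof -
    have all: "imp (all a) (all b) \<in> F" if "imp a b \<in> F" for a b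
    proof (rule implicative_filter_upward_closed[OF assms(3)])
      show "all (imp a b) \<in> F"
        using F that by (simp add: forall_filter_def)
      show "all (imp a b) \<le> imp (all a) (all b)"
        by (rule all_imp_le) (rule boolean_bl_algebra_mult[OF assms(2)])
    qed
    have "imp (ex a) (ex b) \<in> F" if "imp a b \<in> F" for a b
    proof -
      note contraposition = boolean_bl_algebra_contraposition[OF assms(2)]
      \<comment> \<open>By \<open>all_imp_bot\<close> this is the contrapositive of the
        goal.\<close>
      have "imp (all (imp b bot)) (all (imp a bot)) \<in> F"
        using that by (intro all) (simp add: contraposition)
      then show ?thesis
        by (simp add: all_imp_bot contraposition)
    qed
    with all assms(3) show ?thesis
      by (simp add: epistemic_bl_filter_def)
  qed
qed

end
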